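(* Let $X$ be a Banach space and let $\Gamma:[0,1]\to cwk(X)$ be variationally Henstock integrable. Then $\Gamma$ is Bochner measurable.
   Context: $[0,1]$ carries Lebesgue measure $\lambda$; $\mathcal{I}$ is the family of all closed subintervals of $[0,1]$ and $|I|$ the length of $I$. $cwk(X)$ is the family of all non-empty convex weakly compact subsets of $X$, with Minkowski addition, multiplication by scalars, and the Hausdorff distance $d_H$. A multifunction is simple if there is a finite collection of pairwise disjoint measurable subsets of $[0,1]$ (covering $[0,1]$) on each of which it is constant. $\Gamma:[0,1]\to cwk(X)$ is Bochner measurable if there is a sequence of simple multifunctions $\Gamma_n:[0,1]\to cwk(X)$ with $\lim_n d_H(\Gamma_n(t),\Gamma(t))=0$ for almost all $t\in[0,1]$. A gauge is a function $\delta:[0,1]\to(0,\infty)$. A Perron partition of $[0,1]$ is a finite collection $\{(I_1,t_1),\dots,(I_p,t_p)\}$ of non-overlapping closed subintervals with union $[0,1]$ and points $t_i\in I_i$; it is $\delta$-fine if $I_i\subset(t_i-\delta(t_i),t_i+\delta(t_i))$ for all $i$. $\Gamma$ is variationally Henstock integrable if there is a finitely additive $\Phi_\Gamma:\mathcal{I}\to cwk(X)$ such that for every $\varepsilon>0$ there is a gauge $\delta$ with $\sum_{j=1}^p d_H(\Phi_\Gamma(I_j),\Gamma(t_j)|I_j|)<\varepsilon$ for every $\delta$-fine Perron partition of $[0,1]$. *)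

theory Defs
  imports "HOL-Analysis.Analysis"
begin

text \<open>Minkowski addition of sets is the \<open>+\<close> of \<open>HOL-Library.Set_Algebras\<close>, and the multiple \<open>r K\<close>
  is the image \<open>(*\<^sub>R) r ` K\<close>.\<close>

definition weak_topology :: "'a::real_normed_vector topology"
  where "weak_topology =
    topology_generated_by {f -` U | (f :: 'a \<Rightarrow> real) U. bounded_linear f \<and> open U}"

definition cwk :: "'a::real_normed_vector set set"
  where "cwk = {K. K \<noteq> {} \<and> convex K \<and> compactin weak_topology K}"

text \<open>The real-valued suprema and infima are meaningful for non-empty bounded sets only; every
  member of \<open>cwk\<close> is one, since weakly compact sets are norm bounded.\<close>

definition hausdorff_dist :: "'a::metric_space set \<Rightarrow> 'a set \<Rightarrow> real"
  where "hausdorff_dist A B = max (SUP a\<in>A. infdist a B) (SUP b\<in>B. infdist b A)"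

text \<open>A multifunction on \<open>[0,1]\<close> is a set-valued function on the reals whose values outside
  \<open>[0,1]\<close> are irrelevant.\<close>

definition simple_multifunction :: "(real \<Rightarrow> 'b set) \<Rightarrow> bool"
  where "simple_multifunction \<Gamma> \<longleftrightarrow>
    (\<exists>P. finite P \<and> disjoint P \<and> \<Union>P = {0..1} \<and> P \<subseteq> sets lebesgue \<and> (\<forall>A\<in>P. \<Gamma> constant_on A))"

definition Bochner_measurable :: "(real \<Rightarrow> 'a::real_normed_vector set) \<Rightarrow> bool"
  where "Bochner_measurable \<Gamma> \<longleftrightarrow>
    (\<exists>\<Gamma>n :: nat \<Rightarrow> real \<Rightarrow> 'a set.
      (\<forall>n. simple_multifunction (\<Gamma>n n) \<and> \<Gamma>n n \<in> {0..1} \<rightarrow> cwk) \<and>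
      (AE t in lebesgue_on {0..1}. (\<lambda>n. hausdorff_dist (\<Gamma>n n t) (\<Gamma> t)) \<longlonglongrightarrow> 0))"

text \<open>Intervals are non-degenerate. Admitting singletons would not change integrability:
  additivity forces \<open>\<Phi> {c} = {0}\<close>, so a singleton contributes 0 to every sum below.\<close>

definition subintervals :: "real set set"
  where "subintervals = {{a..b} | a b. 0 \<le> a \<and> a < b \<and> b \<le> 1}"

definition finitely_additive :: "(real set \<Rightarrow> 'a::real_normed_vector set) \<Rightarrow> bool"
  where "finitely_additive \<Phi> \<longleftrightarrow>
    (\<forall>I\<in>subintervals. \<forall>J\<in>subintervals.
      interior I \<inter> interior J = {} \<and> I \<union> J \<in> subintervals \<longrightarrow> \<Phi> (I \<union> J) = \<Phi> I + \<Phi> J)"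

text \<open>The pairs of a \<open>tagged_division_of\<close> carry the tag first. That relation admits singleton and
  hence repeated intervals, which the second conjunct excludes.\<close>

definition Perron_partition :: "(real \<times> real set) set \<Rightarrow> bool"
  where "Perron_partition p \<longleftrightarrow> p tagged_division_of {0..1} \<and> snd ` p \<subseteq> subintervals"

definition variationally_Henstock_integrable :: "(real \<Rightarrow> 'a::real_normed_vector set) \<Rightarrow> bool"
  where "variationally_Henstock_integrable \<Gamma> \<longleftrightarrow>
    (\<exists>\<Phi>. \<Phi> \<in> subintervals \<rightarrow> cwk \<and> finitely_additive \<Phi> \<and>
      (\<forall>\<epsilon>>0. \<exists>\<delta> :: real \<Rightarrow> real. (\<forall>t\<in>{0..1}. 0 < \<delta> t) \<and>
        (\<forall>p. Perron_partition p \<and> (\<lambda>t. {t - \<delta> t <..< t + \<delta> t}) fine p \<longrightarrow>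
          (\<Sum>(t, I)\<in>p. hausdorff_dist (\<Phi> I) ((*\<^sub>R) (measure lborel I) ` \<Gamma> t)) < \<epsilon>)))"

end

theory Submission
  imports Defs
begin

text \<open>Let \<open>\<Phi>\<close> be the additive interval function that witnesses the
  integrability of \<open>\<Gamma>\<close>. The approximating simple multifunctions are its
  dyadic difference quotients: with \<open>D\<close> the interval \<open>dyadic_at n t\<close> of
  length \<open>2\<^sup>-\<^sup>n\<close> around \<open>t\<close>, put \<open>\<Gamma>\<^sub>n(t)
  = 2\<^sup>n \<Phi>(D)\<close>. The Hausdorff distance is positively homogeneous, so
  \<open>d\<^sub>H(\<Gamma>\<^sub>n(t), \<Gamma>(t)) \<le> 2\<^sup>n h(t, D)\<close> where
  \<open>h(t, I) = d\<^sub>H(\<Phi>(I), \<bar>I\<bar> \<Gamma>(t))\<close>, and what has to be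
  shown is that the density \<open>2\<^sup>n h(t, D)\<close> tends to \<open>0\<close> for almost
  every \<open>t\<close>. This is a statement about the real function \<open>h\<close> alone
  (\<open>variationally_null_imp_dyadic_limit\<close>): it is nonnegative and its sums over fine
  Perron partitions are arbitrarily small.

  The exceptional set where the density exceeds a given \<open>\<eta> > 0\<close> for infinitely
  many \<open>n\<close> is covered by dyadic intervals \<open>I\<close> that fit the gauge at a
  tag \<open>t\<close> and satisfy \<open>\<eta> \<bar>I\<bar> \<le> h(t, I)\<close>. Dyadic
  intervals are nested or do not overlap, so the maximal members of any finite subfamily have the
  same union and do not overlap (\<open>dyadic_disjoint_subcover\<close>); this takes the place
  of Vitali's covering theorem. They are part of a fine Perron partition
  (\<open>Perron_partition_extend\<close>), hence their total length is at most
  \<open>1/\<eta>\<close> times a sum that the gauge makes arbitrarily small, and the exceptional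
  set is null.

  The suprema that define \<open>hausdorff_dist\<close> are taken in the reals and behave like a
  distance for bounded sets only. So the argument rests on the norm boundedness of weakly compact
  sets (\<open>cwk_bounded\<close>): it follows from the uniform boundedness principle in the
  dual space, which is complete, together with norming functionals, which the Hahn-Banach theorem
  provides.\<close>

section \<open>Linear functionals below a sublinear one\<close>

definition sublinear :: "('a::real_vector \<Rightarrow> real) \<Rightarrow> bool"
  where "sublinear p \<longleftrightarrow> p 0 = 0 \<and> (\<forall>x y. p (x + y) \<le> p x + p y) \<and> (\<forall>c>0. \<forall>x. p (c *\<^sub>R x) \<le> c * p x)"

lemma sublinearD:
  assumes "sublinear p"
  shows "p 0 = 0" "p (x + y) \<le> p x + p y" "c \<ge> 0 \<Longrightarrow> p (c *\<^sub>R x) = c * p x" "- p (- x) \<le> p x"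
proof -
  show p0: "p 0 = 0" and add: "p (x + y) \<le> p x + p y" for x y
    using assms unfolding sublinear_def by auto
  have le: "p (c *\<^sub>R x) \<le> c * p x" if "c > 0" for c x
    using assms that unfolding sublinear_def by auto
  show "p (c *\<^sub>R x) = c * p x" if "c \<ge> 0"
  proof (cases "c = 0")
    case False
    then have c: "c > 0" using that by simp
    have "p x \<le> inverse c * p (c *\<^sub>R x)"
      using le[of "inverse c" "c *\<^sub>R x"] c by simp
    then have "c * p x \<le> p (c *\<^sub>R x)"
      using c by (simp add: field_simps)
    with le[OF c, of x] show ?thesis by simp
  qed (simp add: p0)
  show "- p (- x) \<le> p x"
    using add[of x "- x"] p0 by simp
qed


text \<open>The largest sublinear functional below \<open>p\<close> that is at most \<open>- p v\<close> at \<open>- v\<close>. It is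
  linear on the line through \<open>v\<close>, where it agrees with \<open>p\<close> on the side of \<open>v\<close>.\<close>
definition tilt :: "('a::real_vector \<Rightarrow> real) \<Rightarrow> 'a \<Rightarrow> 'a \<Rightarrow> real"
  where "tilt p v x = (INF t\<in>{0..}. p (x + t *\<^sub>R v) - t * p v)"

lemma
  assumes p: "sublinear p"
  shows sublinear_tilt: "sublinear (tilt p v)"
    and tilt_le: "tilt p v x \<le> p x"
    and tilt_uminus_le: "tilt p v (- v) \<le> - p v"
proof -
  note D = sublinearD[OF p]
  have lower: "- p (- x) \<le> p (x + t *\<^sub>R v) - t * p v" if "t \<ge> 0" for x t
    using D(2)[of "x + t *\<^sub>R v" "- x"] D(3)[OF that, of v] by simp
  have upper: "tilt p v x \<le> p (x + t *\<^sub>R v) - t * p v" if "t \<ge> 0" for x t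
    unfolding tilt_def
  proof (rule cINF_lower)
    show "bdd_below ((\<lambda>t. p (x + t *\<^sub>R v) - t * p v) ` {0..})"
      by (rule bdd_belowI2[where m = "- p (- x)"]) (simp add: lower)
  qed (use that in simp)
  have greatest: "m \<le> tilt p v x" if "\<And>t. t \<ge> 0 \<Longrightarrow> m \<le> p (x + t *\<^sub>R v) - t * p v" for m x
    unfolding tilt_def by (rule cINF_greatest) (use that in auto)
  show "tilt p v x \<le> p x" for x
    using upper[of 0 x] by simp
  show "tilt p v (- v) \<le> - p v"
    using upper[of 1 "- v"] D(1) by simp
  show "sublinear (tilt p v)"
    unfolding sublinear_def
  proof (intro conjI allI impI)
    show "tilt p v 0 = 0"
    proof (rule antisym)
      show "tilt p v 0 \<le> 0"
        using upper[of 0 0] D(1) by simp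
      show "0 \<le> tilt p v 0"
        by (rule greatest) (simp add: D(3))
    qed
    fix x y
    have "tilt p v (x + y) - (p (y + t *\<^sub>R v) - t * p v) \<le> tilt p v x" if "t \<ge> 0" for t
    proof (rule greatest)
      fix s :: real assume "s \<ge> 0"
      then show "tilt p v (x + y) - (p (y + t *\<^sub>R v) - t * p v) \<le> p (x + s *\<^sub>R v) - s * p v"
        using upper[of "s + t" "x + y"] D(2)[of "x + s *\<^sub>R v" "y + t *\<^sub>R v"] that
        by (simp add: algebra_simps)
    qed
    then have "tilt p v (x + y) - tilt p v x \<le> tilt p v y"
      by (intro greatest) (simp add: algebra_simps)
    then show "tilt p v (x + y) \<le> tilt p v x + tilt p v y"
      by simp
  next
    fix c :: real and x assume c: "c > 0"
    have "tilt p v (c *\<^sub>R x) / c \<le> tilt p v x"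
    proof (rule greatest)
      fix t :: real assume t: "t \<ge> 0"
      have "tilt p v (c *\<^sub>R x) \<le> p (c *\<^sub>R (x + t *\<^sub>R v)) - (c * t) * p v"
        using upper[of "c * t" "c *\<^sub>R x"] c t by (simp add: algebra_simps)
      also have "\<dots> = c * (p (x + t *\<^sub>R v) - t * p v)"
        using D(3)[of c "x + t *\<^sub>R v"] c by (simp add: algebra_simps)
      finally show "tilt p v (c *\<^sub>R x) / c \<le> p (x + t *\<^sub>R v) - t * p v"
        using c by (simp add: field_simps)
    qed
    then show "tilt p v (c *\<^sub>R x) \<le> c * tilt p v x"
      using c by (simp add: field_simps)
  qed
qed


text \<open>The infimum of two sublinear functionals need not be subadditive. In a chain, the smaller of
  two members serves both summands at once.\<close>
lemma sublinear_INF_chain: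
  assumes ne: "C \<noteq> {}" and sub: "\<And>p. p \<in> C \<Longrightarrow> sublinear p \<and> p \<le> q"
    and chain: "\<And>p p'. p \<in> C \<Longrightarrow> p' \<in> C \<Longrightarrow> p \<le> p' \<or> p' \<le> p"
  shows "sublinear (\<lambda>x. INF p\<in>C. p x)" and "p \<in> C \<Longrightarrow> (\<lambda>x. INF p\<in>C. p x) \<le> p"
proof -
  let ?u = "\<lambda>x. INF p\<in>C. p x"
  have bdd: "bdd_below ((\<lambda>p. p x) ` C)" for x
  proof (rule bdd_belowI2)
    fix p assume "p \<in> C"
    then show "- q (- x) \<le> p x"
      using sublinearD(4)[of p x] sub[of p] le_funD[of p q "- x"] by force
  qed
  have lower: "?u x \<le> p x" if "p \<in> C" for p x
    using that bdd by (rule cINF_lower[rotated])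
  then show "p \<in> C \<Longrightarrow> ?u \<le> p"
    by (simp add: le_fun_def)
  show "sublinear ?u"
    unfolding sublinear_def
  proof (intro conjI allI impI)
    show "?u 0 = 0"
      using sub sublinearD(1) ne by (metis (mono_tags, lifting) INF_cong cINF_const)
    fix x y
    have "?u (x + y) \<le> p1 x + p2 y" if C: "p1 \<in> C" "p2 \<in> C" for p1 p2
    proof -
      obtain p where p: "p \<in> C" "p \<le> p1" "p \<le> p2"
        using chain[OF C] C by blast
      then have "?u (x + y) \<le> p x + p y"
        using lower[of p "x + y"] sublinearD(2)[of p x y] sub[of p] by force
      also have "\<dots> \<le> p1 x + p2 y"
        using p by (simp add: add_mono le_funD)
      finally show ?thesis .
    qed
    then have "?u (x + y) - p2 y \<le> ?u x" if "p2 \<in> C" for p2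
      using that by (intro cINF_greatest[OF ne]) (simp add: algebra_simps)
    then have "?u (x + y) - ?u x \<le> ?u y"
      by (intro cINF_greatest[OF ne]) (simp add: algebra_simps)
    then show "?u (x + y) \<le> ?u x + ?u y" by simp
  next
    fix c :: real and x assume c: "c > 0"
    have "?u (c *\<^sub>R x) / c \<le> ?u x"
    proof (rule cINF_greatest[OF ne])
      fix p assume "p \<in> C"
      then show "?u (c *\<^sub>R x) / c \<le> p x"
        using lower[of p "c *\<^sub>R x"] sublinearD(3)[of p c x] sub[of p] c by (simp add: field_simps)
    qed
    then show "?u (c *\<^sub>R x) \<le> c * ?u x"
      using c by (simp add: field_simps)
  qed
qed

lemma exists_minimal_sublinear:
  assumes q: "sublinear q"
  obtains m where "sublinear m" "m \<le> q" "\<And>p. sublinear p \<Longrightarrow> p \<le> m \<Longrightarrow> p = m"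
proof -
  let ?A = "{p. sublinear p \<and> p \<le> q}"
  have "\<exists>m\<in>?A. \<forall>a\<in>?A. a \<le> m \<longrightarrow> a = m"
  proof (rule predicate_Zorn)
    show "partial_order_on ?A (relation_of (\<lambda>a b. b \<le> a) ?A)"
      by (rule partial_order_on_relation_ofI) auto
    fix C assume C: "C \<in> Chains (relation_of (\<lambda>a b. b \<le> a) ?A)"
    show "\<exists>u\<in>?A. \<forall>a\<in>C. u \<le> a"
    proof (cases "C = {}")
      case True
      then show ?thesis using q by auto
    next
      case False
      have sub: "\<And>p. p \<in> C \<Longrightarrow> sublinear p \<and> p \<le> q"
        and ch: "\<And>p p'. p \<in> C \<Longrightarrow> p' \<in> C \<Longrightarrow> p \<le> p' \<or> p' \<le> p"
        using C unfolding Chains_def relation_of_def by blast+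
      have le: "(\<lambda>x. INF p\<in>C. p x) \<le> p" if "p \<in> C" for p
        using sublinear_INF_chain(2)[OF False sub ch that] .
      moreover have "(\<lambda>x. INF p\<in>C. p x) \<le> q"
        using False le sub by (meson all_not_in_conv order_trans)
      ultimately show ?thesis
        using sublinear_INF_chain(1)[OF False sub ch] by blast
    qed
  qed
  then obtain m where m: "sublinear m" "m \<le> q" "\<And>a. sublinear a \<Longrightarrow> a \<le> q \<Longrightarrow> a \<le> m \<Longrightarrow> a = m"
    by blast
  show ?thesis
    by (rule that[of m]) (use m in \<open>auto intro: order_trans\<close>)
qed


text \<open>By minimality all tilts of \<open>m\<close> coincide with \<open>m\<close>, so that \<open>m\<close> is odd; and an odd subadditive
  function is additive.\<close>
lemma minimal_sublinear_linear:
  assumes m: "sublinear m" and min: "\<And>p. sublinear p \<Longrightarrow> p \<le> m \<Longrightarrow> p = m"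
  shows "linear m"
proof -
  note D = sublinearD[OF m]
  have eq: "tilt m v = m" for v
    using min[OF sublinear_tilt[OF m]] tilt_le[OF m] by (simp add: le_fun_def)
  have neg: "m (- v) = - m v" for v
    using tilt_uminus_le[OF m, of v] eq[of v] D(4)[of v] by simp
  show ?thesis
  proof (rule linearI)
    fix x y
    show "m (x + y) = m x + m y"
      using D(2)[of x y] D(2)[of "- x" "- y"] neg[of x] neg[of y] neg[of "x + y"] by simp
  next
    fix c :: real and x
    show "m (c *\<^sub>R x) = c *\<^sub>R m x"
    proof (cases "c \<ge> 0")
      case False
      then have "m (- (c *\<^sub>R x)) = (- c) * m x"
        using D(3)[of "- c" x] by simp
      then show ?thesis using neg[of "c *\<^sub>R x"] by simp
    qed (simp add: D(3))
  qed
qed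


text \<open>A minimal sublinear functional below the tilt of the norm by \<open>v\<close> is linear and bounded by the
  norm; the tilt makes its value at \<open>v\<close> as large as the norm permits. This is the
  Hahn-Banach theorem for the norm.\<close>
lemma norming_functional:
  fixes v :: "'a::real_normed_vector"
  obtains f :: "'a \<Rightarrow>\<^sub>L real" where "norm f \<le> 1" "blinfun_apply f v = norm v"
proof -
  have N: "sublinear (norm :: 'a \<Rightarrow> real)"
    unfolding sublinear_def by (auto intro: norm_triangle_ineq)
  obtain m where m: "sublinear m" "m \<le> tilt norm v"
    and min: "\<And>p. sublinear p \<Longrightarrow> p \<le> m \<Longrightarrow> p = m"
    using exists_minimal_sublinear[OF sublinear_tilt[OF N]] by metis
  have lin: "linear m"
    using minimal_sublinear_linear m(1) min by blast
  have le: "m x \<le> norm x" for x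
    using le_funD[OF m(2), of x] tilt_le[OF N, of v x] by linarith
  have abs: "norm (m x) \<le> norm x * 1" for x
    using le[of x] le[of "- x"] linear_neg[OF lin, of x] by (simp add: abs_le_iff)
  have bl: "bounded_linear m"
    using abs lin by (auto simp: linear_conv_bounded_linear bounded_linear_def bounded_linear_axioms_def
        intro!: exI[of _ 1])
  have "m (- v) \<le> - norm v"
    using le_funD[OF m(2), of "- v"] tilt_uminus_le[OF N, of v] by linarith
  then have "m v = norm v"
    using le[of v] linear_neg[OF lin, of v] by simp
  moreover have "norm (Blinfun m) \<le> 1"
    by (rule norm_blinfun_bound) (use abs in \<open>auto simp: bounded_linear_Blinfun_apply[OF bl] mult.commute\<close>)
  ultimately show ?thesis
    using that[of "Blinfun m"] by (simp add: bounded_linear_Blinfun_apply[OF bl])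
qed


section \<open>Weakly compact sets are norm bounded\<close>

text \<open>The functionals that are bounded by \<open>n\<close> on \<open>K\<close> form closed sets that exhaust the dual, so by
  Baire one of them contains a ball. Up to the factor \<open>r\<close>, every functional of norm at most \<open>1\<close> is a
  difference of two points of this ball; taking it norming for \<open>x \<in> K\<close> bounds the norm of
  \<open>x\<close>.\<close>
lemma weakly_bounded_imp_bounded:
  fixes K :: "'a::real_normed_vector set"
  assumes wb: "\<And>f::'a \<Rightarrow>\<^sub>L real. bounded (blinfun_apply f ` K)"
  shows "bounded K"
proof -
  define C where "C n = {f::'a \<Rightarrow>\<^sub>L real. \<forall>x\<in>K. \<bar>blinfun_apply f x\<bar> \<le> real n}" for n
  have closed: "closed (C n)" for n
    unfolding C_def Collect_ball_eq
    by (intro closed_INT ballI closed_Collect_le continuous_intros)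
  have cover: "(\<Union>n. C n) = UNIV"
  proof -
    have "\<exists>n. f \<in> C n" for f
    proof -
      obtain B where "\<And>x. x \<in> K \<Longrightarrow> \<bar>blinfun_apply f x\<bar> \<le> B"
        using wb[of f] by (auto simp: bounded_iff)
      then show ?thesis
        unfolding C_def using real_arch_simple[of B] order_trans by blast
    qed
    then show ?thesis by auto
  qed
  have "\<exists>n. interior (C n) \<noteq> {}"
  proof (rule ccontr)
    assume "\<nexists>n. interior (C n) \<noteq> {}"
    then have "euclidean interior_of \<Union>(range C) = {}"
      by (intro Baire_category_alt) (auto simp: closed completely_metrizable_space_euclidean)
    then show False
      by (simp add: cover)
  qed
  then obtain n f0 r where r: "r > 0" and ball: "cball f0 r \<subseteq> C n"
    by (metis all_not_in_conv mem_interior_cball)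
  have "norm x \<le> 2 * n / r" if x: "x \<in> K" for x
  proof -
    obtain f :: "'a \<Rightarrow>\<^sub>L real" where f: "norm f \<le> 1" "blinfun_apply f x = norm x"
      by (rule norming_functional)
    have "f0 \<in> C n" "f0 + r *\<^sub>R f \<in> C n"
      using ball r f(1) by (auto simp: dist_norm subset_iff mult_le_one)
    then have "\<bar>blinfun_apply f0 x\<bar> \<le> n" "\<bar>blinfun_apply f0 x + r * norm x\<bar> \<le> n"
      using x f(2) by (auto simp: C_def blinfun.add_left blinfun.scaleR_left)
    then have "r * norm x \<le> 2 * n" by linarith
    then show ?thesis using r by (simp add: field_simps)
  qed
  then show ?thesis by (auto simp: bounded_iff)
qed

lemma topspace_weak_topology [simp]: "topspace (weak_topology :: 'a::real_normed_vector topology) = UNIV"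
proof -
  have "UNIV \<in> {f -` U | (f :: 'a \<Rightarrow> real) U. bounded_linear f \<and> open U}"
    using bounded_linear_zero open_UNIV by (metis (mono_tags, lifting) mem_Collect_eq vimage_UNIV)
  then show ?thesis
    unfolding weak_topology_def topology_generated_by_topspace by (intro equalityI subset_UNIV Union_upper)
qed

lemma openin_weak_topology:
  fixes f :: "'a::real_normed_vector \<Rightarrow> real"
  assumes "bounded_linear f" "open U"
  shows "openin weak_topology (f -` U)"
  unfolding weak_topology_def by (rule topology_generated_by_Basis) (use assms in blast)

lemma continuous_map_weak_functional:
  fixes f :: "'a::real_normed_vector \<Rightarrow> real"
  assumes "bounded_linear f"
  shows "continuous_map weak_topology euclideanreal f"
  using openin_weak_topology[OF assms] by (auto simp: continuous_map_alt)

lemma continuous_map_weak_weak: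
  fixes g :: "'a::real_normed_vector \<Rightarrow> 'b::real_normed_vector"
  assumes g: "bounded_linear g"
  shows "continuous_map weak_topology weak_topology g"
proof -
  have "openin weak_topology (g -` (f -` U))" if "bounded_linear f" "open U" for f :: "'b \<Rightarrow> real" and U
    using openin_weak_topology[OF bounded_linear_compose[OF that(1) g] that(2)]
    by (simp add: vimage_def)
  moreover have "\<Union> {f -` U | (f :: 'b \<Rightarrow> real) U. bounded_linear f \<and> open U} = UNIV"
    using topspace_weak_topology[where 'a='b] by (simp add: weak_topology_def)
  ultimately show ?thesis
    unfolding weak_topology_def[where 'a='b] continuous_on_generated_topo_iff by auto
qed

lemma cwk_nonempty: "K \<in> cwk \<Longrightarrow> K \<noteq> {}"
  by (simp add: cwk_def)

lemma cwk_bounded: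
  assumes "K \<in> cwk"
  shows "bounded K"
proof (rule weakly_bounded_imp_bounded)
  fix f :: "'a \<Rightarrow>\<^sub>L real"
  have "compact (blinfun_apply f ` K)"
    using image_compactin[OF _ continuous_map_weak_functional[OF blinfun.bounded_linear_right], of K f] assms
    by (simp add: cwk_def)
  then show "bounded (blinfun_apply f ` K)"
    by (rule compact_imp_bounded)
qed

lemma cwk_scaleR:
  assumes "K \<in> cwk"
  shows "(*\<^sub>R) c ` K \<in> cwk"
  using assms image_compactin[OF _ continuous_map_weak_weak[OF bounded_linear_scaleR_right[of c]], of K]
  by (simp add: cwk_def convex_scaling)


section \<open>The Hausdorff distance of bounded sets\<close>

lemma bdd_above_infdist:
  assumes "bounded A"
  shows "bdd_above ((\<lambda>a. infdist a B) ` A)"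
proof (cases "B = {}")
  case False
  then obtain b where b: "b \<in> B" by blast
  obtain e where e: "\<And>a. a \<in> A \<Longrightarrow> dist b a \<le> e"
    using assms bounded_any_center[of A b] by auto
  show ?thesis
    by (rule bdd_aboveI2[where M=e]) (use e b infdist_le[of b B] in \<open>metis dist_commute order_trans\<close>)
qed (auto simp: infdist_def intro: bdd_aboveI2[where M=0])

lemma hausdorff_dist_nonneg:
  assumes "bounded A" "A \<noteq> {}"
  shows "0 \<le> hausdorff_dist A B"
proof -
  obtain a where a: "a \<in> A" using assms by blast
  have "0 \<le> infdist a B" by (rule infdist_nonneg)
  also have "\<dots> \<le> (SUP a\<in>A. infdist a B)"
    by (rule cSUP_upper[OF a bdd_above_infdist[OF assms(1)]])
  finally show ?thesis by (simp add: hausdorff_dist_def)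
qed

lemma infdist_scaleR_image_le:
  fixes a :: "'a::real_normed_vector"
  assumes "B \<noteq> {}" "c > 0"
  shows "infdist (c *\<^sub>R a) ((*\<^sub>R) c ` B) \<le> c * infdist a B"
proof -
  have "infdist (c *\<^sub>R a) ((*\<^sub>R) c ` B) / c \<le> dist a b" if b: "b \<in> B" for b
  proof -
    have "infdist (c *\<^sub>R a) ((*\<^sub>R) c ` B) \<le> dist (c *\<^sub>R a) (c *\<^sub>R b)"
      using b by (intro infdist_le) auto
    also have "\<dots> = c * dist a b"
      using assms(2) by (simp add: dist_norm flip: scaleR_diff_right)
    finally show ?thesis using assms(2) by (simp add: field_simps)
  qed
  then have "infdist (c *\<^sub>R a) ((*\<^sub>R) c ` B) / c \<le> infdist a B"
    using assms(1) by (simp add: infdist_notempty cINF_greatest)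
  then show ?thesis using assms(2) by (simp add: field_simps)
qed

lemma hausdorff_dist_scaleR_image_le:
  fixes A B :: "'a::real_normed_vector set"
  assumes A: "bounded A" "A \<noteq> {}" and B: "bounded B" "B \<noteq> {}" and c: "c > 0"
  shows "hausdorff_dist ((*\<^sub>R) c ` A) ((*\<^sub>R) c ` B) \<le> c * hausdorff_dist A B"
proof -
  have *: "(SUP a\<in>(*\<^sub>R) c ` A. infdist a ((*\<^sub>R) c ` B)) \<le> c * (SUP a\<in>A. infdist a B)"
    if A: "bounded A" "A \<noteq> {}" and B: "B \<noteq> {}" for A B :: "'a set"
  proof (rule cSUP_least)
    fix x assume "x \<in> (*\<^sub>R) c ` A"
    then obtain a where a: "a \<in> A" "x = c *\<^sub>R a" by blast
    have "infdist x ((*\<^sub>R) c ` B) \<le> c * infdist a B"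
      using infdist_scaleR_image_le[OF B c] a by simp
    also have "\<dots> \<le> c * (SUP a\<in>A. infdist a B)"
      using c cSUP_upper[OF a(1) bdd_above_infdist[OF A(1)]] by simp
    finally show "infdist x ((*\<^sub>R) c ` B) \<le> c * (SUP a\<in>A. infdist a B)" .
  qed (use A in simp)
  show ?thesis
    using *[OF A B(2)] *[OF B A(2)] c
    by (auto simp: hausdorff_dist_def max_mult_distrib_left)
qed


section \<open>Completing tagged intervals to a Perron partition\<close>

text \<open>The complement of the given intervals is divided arbitrarily and then refined by Cousin's
  lemma; intervals that are fine for their tags survive the refinement. Both steps may create
  degenerate intervals, which are discarded at the end: the remaining ones still cover \<open>[0,1]\<close>.\<close>
lemma Perron_partition_extend:
  fixes \<delta> :: "real \<Rightarrow> real"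
  assumes fin: "finite F" and F: "F \<subseteq> subintervals"
    and disj: "pairwise (\<lambda>I J. interior I \<inter> interior J = {}) F"
    and tag: "\<And>I. I \<in> F \<Longrightarrow> \<tau> I \<in> I" and fine: "\<And>I. I \<in> F \<Longrightarrow> I \<subseteq> {\<tau> I - \<delta> (\<tau> I) <..< \<tau> I + \<delta> (\<tau> I)}"
    and \<delta>: "\<And>t. t \<in> {0..1} \<Longrightarrow> 0 < \<delta> t"
  obtains p where "Perron_partition p" "(\<lambda>t. {t - \<delta> t <..< t + \<delta> t}) fine p" "(\<lambda>I. (\<tau> I, I)) ` F \<subseteq> p"
proof -
  have Fcb: "I \<noteq> {} \<and> I \<subseteq> cbox 0 1 \<and> (\<exists>a b. I = cbox a b) \<and> measure lborel I \<noteq> 0" if I: "I \<in> F" for I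
  proof -
    obtain a b where "I = {a..b}" "0 \<le> a" "a < b" "b \<le> 1"
      using F I by (auto simp: subintervals_def)
    then show ?thesis
      unfolding box_real by (intro conjI exI[of _ a] exI[of _ b]) auto
  qed
  have "F division_of \<Union>F"
  proof (rule division_ofI)
    show "I \<noteq> {}" "\<exists>a b. I = cbox a b" if "I \<in> F" for I
      using Fcb[OF that] by blast+
    show "interior I \<inter> interior J = {}" if "I \<in> F" "J \<in> F" "I \<noteq> J" for I J
      using pairwiseD[OF disj that] .
  qed (use fin in auto)
  moreover have "\<Union>F \<subseteq> cbox 0 1"
    using Fcb by blast
  ultimately obtain q where q: "F \<subseteq> q" "q division_of cbox 0 (1::real)"
    by (rule partial_division_extend_interval)
  note qD = division_ofD[OF q(2)]
  define \<sigma> where "\<sigma> I = (if I \<in> F then \<tau> I else SOME x. x \<in> I)" for I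
  have \<sigma>: "\<sigma> I \<in> I" if "I \<in> q" for I
    using tag[of I] qD(3)[OF that] some_in_eq[of I] by (simp add: \<sigma>_def)
  have ptag: "(\<lambda>I. (\<sigma> I, I)) ` q tagged_division_of cbox 0 (1::real)"
  proof (rule tagged_division_ofI)
    show "finite ((\<lambda>I. (\<sigma> I, I)) ` q)"
      using qD(1) by simp
    fix x K assume xK: "(x, K) \<in> (\<lambda>I. (\<sigma> I, I)) ` q"
    show "x \<in> K" "K \<subseteq> cbox 0 1" "\<exists>a b. K = cbox a b"
      using xK \<sigma> qD(2,4) by blast+
    fix y L assume "(y, L) \<in> (\<lambda>I. (\<sigma> I, I)) ` q" "(x, K) \<noteq> (y, L)"
    then show "interior K \<inter> interior L = {}"
      using xK qD(5)[of K L] by blast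
  next
    have "{K. \<exists>x. (x, K) \<in> (\<lambda>I. (\<sigma> I, I)) ` q} = q" by blast
    then show "\<Union>{K. \<exists>x. (x, K) \<in> (\<lambda>I. (\<sigma> I, I)) ` q} = cbox 0 1"
      using qD(6) by simp
  qed
  (* gauges live on the whole line; the value outside [0,1] is arbitrary since tags lie inside *)
  define \<gamma> where "\<gamma> t = (if t \<in> {0..1} then {t - \<delta> t <..< t + \<delta> t} else UNIV)" for t
  have "gauge \<gamma>"
    using \<delta> by (auto simp: gauge_def \<gamma>_def)
  from tagged_division_finer[OF ptag this]
  obtain r where r: "r tagged_division_of cbox 0 1" "\<gamma> fine r"
    and keep: "\<forall>(x, K) \<in> (\<lambda>I. (\<sigma> I, I)) ` q. K \<subseteq> \<gamma> x \<longrightarrow> (x, K) \<in> r"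
    by blast
  note rD = tagged_division_ofD[OF r(1)]
  define p where "p = {(x, K) \<in> r. measure lborel K \<noteq> 0}"
  have "{k \<in> snd ` r. measure lborel k \<noteq> 0} division_of cbox 0 1"
    by (rule division_of_nontrivial[OF division_of_tagged_division[OF r(1)]]) simp
  then have "\<Union>{k \<in> snd ` r. measure lborel k \<noteq> 0} = cbox 0 1"
    by (rule division_ofD(6))
  moreover have "{k \<in> snd ` r. measure lborel k \<noteq> 0} = {K. \<exists>x. (x, K) \<in> p}"
    by (force simp: p_def)
  ultimately have Un: "\<Union>{K. \<exists>x. (x, K) \<in> p} = cbox 0 1"
    by simp
  have "p \<subseteq> r" by (auto simp: p_def)
  have "p tagged_division_of cbox 0 1"
  proof (rule tagged_division_ofI[OF _ _ _ _ _ Un])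
    show "finite p" using \<open>p \<subseteq> r\<close> rD(1) by (rule finite_subset)
    fix x K assume xK: "(x, K) \<in> p"
    show "x \<in> K" "K \<subseteq> cbox 0 1" "\<exists>a b. K = cbox a b"
      using xK \<open>p \<subseteq> r\<close> rD(2-4) by blast+
    fix y L assume "(y, L) \<in> p" "(x, K) \<noteq> (y, L)"
    then show "interior K \<inter> interior L = {}"
      using xK \<open>p \<subseteq> r\<close> by (intro rD(5)) blast+
  qed
  moreover have "K \<in> subintervals" if "(x, K) \<in> p" for x K
  proof -
    have "(x, K) \<in> r" "measure lborel K \<noteq> 0" using that by (auto simp: p_def)
    moreover then obtain a b where "K = {a..b}" using rD(4) by force
    ultimately show ?thesis
      using rD(3)[of x K] by (auto simp: subintervals_def content_real_if split: if_splits)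
  qed
  ultimately have "Perron_partition p"
    unfolding Perron_partition_def by auto
  moreover have "(\<lambda>t. {t - \<delta> t <..< t + \<delta> t}) fine p"
  proof (rule fineI)
    fix x K assume "(x, K) \<in> p"
    then have "(x, K) \<in> r" by (simp add: p_def)
    then have "x \<in> {0..1}" "K \<subseteq> \<gamma> x"
      using fineD[OF r(2)] rD(2,3)[of x K] by auto
    then show "K \<subseteq> {x - \<delta> x <..< x + \<delta> x}"
      by (simp add: \<gamma>_def)
  qed
  moreover have "(\<tau> I, I) \<in> p" if I: "I \<in> F" for I
  proof -
    have "\<tau> I \<in> {0..1}" using tag[OF I] Fcb[OF I] by auto
    then have "I \<subseteq> \<gamma> (\<sigma> I)" using fine[OF I] I by (simp add: \<gamma>_def \<sigma>_def)
    then have "(\<sigma> I, I) \<in> r" using keep I q(1) by blast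
    then show ?thesis using I Fcb[OF I] by (simp add: p_def \<sigma>_def)
  qed
  ultimately show ?thesis using that by blast
qed

section \<open>Dyadic intervals\<close>

text \<open>Closed, so that they are admissible in Perron partitions.\<close>
definition dyadic :: "nat \<Rightarrow> int \<Rightarrow> real set"
  where "dyadic n k = {of_int k / 2 ^ n .. of_int (k + 1) / 2 ^ n}"

lemma dyadic_nested:
  assumes le: "n \<le> m" and meet: "interior (dyadic n k) \<inter> interior (dyadic m j) \<noteq> {}"
  shows "dyadic m j \<subseteq> dyadic n k"
proof -
  (* on the grid of mesh 1 / 2 ^ m all four end points are integers, where strict inequalities gain 1 *)
  define d where "d = m - n"
  have m: "m = n + d" using le by (simp add: d_def)
  obtain x :: real where x: "of_int k / 2 ^ n < x" "x < of_int (k + 1) / 2 ^ n"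
      "of_int j / 2 ^ m < x" "x < of_int (j + 1) / 2 ^ m"
    using meet unfolding ex_in_conv[symmetric] by (auto simp: dyadic_def)
  have c: "of_int i / 2 ^ n = (of_int (i * 2 ^ d) / 2 ^ m :: real)" for i
    by (simp add: m power_add)
  have "of_int j / 2 ^ m < (of_int ((k + 1) * 2 ^ d) / 2 ^ m :: real)"
    using x c[of "k + 1"] by linarith
  then have "j < (k + 1) * 2 ^ d"
    by (simp only: divide_less_cancel of_int_less_iff) auto
  then have 1: "j + 1 \<le> (k + 1) * 2 ^ d" by simp
  have "of_int (k * 2 ^ d) / 2 ^ m < (of_int (j + 1) / 2 ^ m :: real)"
    using x c[of k] by linarith
  then have "k * 2 ^ d < j + 1"
    by (simp only: divide_less_cancel of_int_less_iff) auto
  then have 2: "k * 2 ^ d \<le> j" by simp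
  have "of_int (j + 1) / 2 ^ m \<le> (of_int ((k + 1) * 2 ^ d) / 2 ^ m :: real)"
    using 1 by (intro divide_right_mono) (simp_all only: of_int_le_iff, simp)
  moreover have "of_int (k * 2 ^ d) / 2 ^ m \<le> (of_int j / 2 ^ m :: real)"
    using 2 by (intro divide_right_mono) (simp_all only: of_int_le_iff, simp)
  ultimately show ?thesis
    unfolding dyadic_def c[of k] c[of "k + 1"] by simp
qed

lemma dyadic_disjoint_subcover:
  assumes fin: "finite E" and E: "\<And>I. I \<in> E \<Longrightarrow> \<exists>n k. I = dyadic n k"
  obtains M where "M \<subseteq> E" "\<Union>M = \<Union>E" "pairwise (\<lambda>I J. interior I \<inter> interior J = {}) M"
proof
  let ?M = "{I \<in> E. \<forall>J\<in>E. I \<subseteq> J \<longrightarrow> J = I}"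
  show "?M \<subseteq> E" by auto
  have "\<exists>J\<in>?M. I \<subseteq> J" if I: "I \<in> E" for I
  proof -
    obtain J where "J \<in> E" "I \<subseteq> J" "\<And>L. L \<in> E \<Longrightarrow> J \<subseteq> L \<Longrightarrow> L = J"
      using finite_has_maximal2[OF fin I] by metis
    then show ?thesis by (intro bexI[of _ J]) simp_all
  qed
  then have "I \<subseteq> \<Union>?M" if "I \<in> E" for I
    using that by (meson Union_upper order_trans)
  then have "\<Union>E \<subseteq> \<Union>?M"
    by (rule Union_least)
  moreover have "\<Union>?M \<subseteq> \<Union>E"
    by (rule Union_mono) simp
  ultimately show "\<Union>?M = \<Union>E"
    by (rule antisym[rotated])
  show "pairwise (\<lambda>I J. interior I \<inter> interior J = {}) ?M"
  proof (rule pairwiseI, rule ccontr)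
    fix I J assume IJ: "I \<in> ?M" "J \<in> ?M" "I \<noteq> J" "interior I \<inter> interior J \<noteq> {}"
    have "I \<in> E" "J \<in> E" using IJ(1,2) by simp_all
    then obtain n k m j where nk: "I = dyadic n k" and mj: "J = dyadic m j"
      using E by metis
    have "I \<subseteq> J \<or> J \<subseteq> I"
    proof (cases "n \<le> m")
      case True
      then show ?thesis
        using dyadic_nested[of n m k j] IJ(4) unfolding nk mj by simp
    next
      case False
      then show ?thesis
        using dyadic_nested[of m n j k] IJ(4) unfolding nk mj by (simp add: Int_commute)
    qed
    then show False using IJ(1-3) by auto
  qed
qed

abbreviation dyadic_at :: "nat \<Rightarrow> real \<Rightarrow> real set"
  where "dyadic_at n t \<equiv> dyadic n \<lfloor>2 ^ n * t\<rfloor>"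

lemma mem_dyadic_at: "t \<in> dyadic_at n t"
  unfolding dyadic_def by (simp add: field_simps) linarith

lemma measure_dyadic: "measure lborel (dyadic n k) = 1 / 2 ^ n" "measure lebesgue (dyadic n k) = 1 / 2 ^ n"
proof -
  have "real_of_int k / 2 ^ n \<le> of_int (k + 1) / 2 ^ n"
    by (rule divide_right_mono) auto
  then show "measure lborel (dyadic n k) = 1 / 2 ^ n"
    unfolding dyadic_def by (simp add: field_simps)
  then show "measure lebesgue (dyadic n k) = 1 / 2 ^ n"
    by (simp add: dyadic_def)
qed

lemma dyadic_in_subintervals:
  assumes "0 \<le> k" "k < 2 ^ n"
  shows "dyadic n k \<in> subintervals"
proof -
  have "real_of_int (k + 1) \<le> of_int (2 ^ n)"
    using assms by (simp only: of_int_le_iff)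
  then have "real_of_int (k + 1) / 2 ^ n \<le> 1" by simp
  moreover have "real_of_int k / 2 ^ n < of_int (k + 1) / 2 ^ n"
    by (rule divide_strict_right_mono) auto
  ultimately show ?thesis
    using assms(1) unfolding subintervals_def dyadic_def by (intro CollectI exI conjI) auto
qed

lemma floor_dyadic_bounds:
  assumes "t \<in> {0..<1::real}"
  shows "0 \<le> \<lfloor>2 ^ n * t\<rfloor>" "\<lfloor>2 ^ n * t\<rfloor> < 2 ^ n"
  using assms by (auto simp: floor_less_iff)

lemma dyadic_subset_ball:
  assumes "t \<in> dyadic n k" "1 / 2 ^ n < d"
  shows "dyadic n k \<subseteq> {t - d <..< t + d}"
  using assms by (auto simp: dyadic_def add_divide_distrib)


section \<open>Differentiation along dyadic intervals\<close>

text \<open>Almost everywhere differentiability with derivative \<open>0\<close>, for interval functions that depend on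
  a tag. The intervals in \<open>V\<close> below carry too much of \<open>h\<close> compared with their length; as any finite
  non-overlapping family of them occurs in a fine Perron partition, their lengths cannot add up to
  more than \<open>e\<close>.\<close>
lemma variationally_null_imp_dyadic_limit:
  fixes h :: "real \<Rightarrow> real set \<Rightarrow> real"
  assumes nonneg: "\<And>t I. t \<in> {0..1} \<Longrightarrow> I \<in> subintervals \<Longrightarrow> 0 \<le> h t I"
    and null: "\<And>\<epsilon>. \<epsilon> > 0 \<Longrightarrow> \<exists>\<delta> :: real \<Rightarrow> real. (\<forall>t\<in>{0..1}. 0 < \<delta> t) \<and>
        (\<forall>p. Perron_partition p \<and> (\<lambda>t. {t - \<delta> t <..< t + \<delta> t}) fine p \<longrightarrow> (\<Sum>(t, I)\<in>p. h t I) < \<epsilon>)"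
  shows "AE t in lebesgue_on {0..1}. (\<lambda>n. 2 ^ n * h t (dyadic_at n t)) \<longlonglongrightarrow> 0"
proof -
  define E where "E \<eta> = {t \<in> {0..<1}. \<not> eventually (\<lambda>n. 2 ^ n * h t (dyadic_at n t) \<le> \<eta>) sequentially}"
    for \<eta> :: real
  have negl: "negligible (E \<eta>)" if \<eta>: "\<eta> > 0" for \<eta>
    unfolding negligible_outer_le
  proof (intro allI impI)
    fix e :: real assume e: "e > 0"
    obtain \<delta> where "\<forall>t\<in>{0..1}. 0 < \<delta> t"
      "\<forall>p. Perron_partition p \<and> (\<lambda>t. {t - \<delta> t <..< t + \<delta> t}) fine p \<longrightarrow> (\<Sum>(t, I)\<in>p. h t I) < \<eta> * e"
      using null[OF mult_pos_pos[OF \<eta> e]] by blast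
    then have \<delta>: "\<And>t. t \<in> {0..1} \<Longrightarrow> 0 < \<delta> t"
      and small: "\<And>p. Perron_partition p \<Longrightarrow> (\<lambda>t. {t - \<delta> t <..< t + \<delta> t}) fine p \<Longrightarrow> (\<Sum>(t, I)\<in>p. h t I) < \<eta> * e"
      by blast+
    define bad where "bad t I \<longleftrightarrow> t \<in> {0..<1} \<and> t \<in> I \<and> I \<in> subintervals \<and> I \<subseteq> {t - \<delta> t <..< t + \<delta> t} \<and>
      \<eta> * measure lebesgue I \<le> h t I" for t I
    define V where "V = {I. (\<exists>n k. I = dyadic n k) \<and> (\<exists>t. bad t I)}"
    have cover: "E \<eta> \<subseteq> \<Union>V"
    proof
      fix t assume "t \<in> E \<eta>"
      then have t: "t \<in> {0..<1}" and freq: "\<exists>\<^sub>F n in sequentially. \<eta> < 2 ^ n * h t (dyadic_at n t)"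
        by (auto simp: E_def not_eventually not_le)
      have "(\<lambda>n. 1 / 2 ^ n :: real) \<longlonglongrightarrow> 0"
        using LIMSEQ_power_zero[of "1/2::real"] by (simp add: power_one_over)
      then have "\<forall>\<^sub>F n in sequentially. 1 / 2 ^ n < \<delta> t"
        using \<delta>[of t] t by (intro order_tendstoD) auto
      then obtain n where n: "\<eta> < 2 ^ n * h t (dyadic_at n t)" "1 / 2 ^ n < \<delta> t"
        using frequently_eventually_frequently[OF freq] by (blast dest: frequently_ex)
      have "bad t (dyadic_at n t)"
        unfolding bad_def
        using t mem_dyadic_at dyadic_subset_ball[OF mem_dyadic_at n(2)] n(1)
          dyadic_in_subintervals[OF floor_dyadic_bounds[OF t]]
        by (auto simp: measure_dyadic field_simps)
      then show "t \<in> \<Union>V"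
        using mem_dyadic_at unfolding V_def by blast
    qed
    have "V \<subseteq> (\<lambda>(n, k). dyadic n k) ` UNIV"
      by (auto simp: V_def)
    then have count: "countable V"
      by (rule countable_subset) auto
    have meas: "I \<in> lmeasurable" if "I \<in> V" for I
      using that by (auto simp: V_def dyadic_def)
    have bound: "measure lebesgue (\<Union>D) \<le> e" if D: "D \<subseteq> V" "finite D" for D
    proof -
      obtain M where M: "M \<subseteq> D" "\<Union>M = \<Union>D" "pairwise (\<lambda>I J. interior I \<inter> interior J = {}) M"
        by (rule dyadic_disjoint_subcover[OF D(2)]) (use D(1) in \<open>auto simp: V_def\<close>)
      have finM: "finite M" using M(1) D(2) by (rule finite_subset)
      have "\<exists>t. bad t I" if "I \<in> M" for I
        using that M(1) D(1) by (auto simp: V_def)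
      then obtain \<tau> where \<tau>: "\<And>I. I \<in> M \<Longrightarrow> bad (\<tau> I) I" by metis
      obtain p where p: "Perron_partition p" "(\<lambda>t. {t - \<delta> t <..< t + \<delta> t}) fine p"
          "(\<lambda>I. (\<tau> I, I)) ` M \<subseteq> p"
      proof (rule Perron_partition_extend[OF finM _ M(3)])
        show "M \<subseteq> subintervals"
          using \<tau> unfolding bad_def by blast
        show "\<tau> I \<in> I" "I \<subseteq> {\<tau> I - \<delta> (\<tau> I) <..< \<tau> I + \<delta> (\<tau> I)}" if "I \<in> M" for I
          using \<tau>[OF that] unfolding bad_def by blast+
      qed (use \<delta> in blast)+
      have pD: "finite p" "\<And>t I. (t, I) \<in> p \<Longrightarrow> 0 \<le> h t I"
      proof -
        have tag: "p tagged_division_of {0..1}" and sub: "snd ` p \<subseteq> subintervals"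
          using p(1) by (auto simp: Perron_partition_def)
        show "finite p" using tag by (rule tagged_division_ofD)
        fix t I assume "(t, I) \<in> p"
        then have "t \<in> {0..1}" "I \<in> subintervals"
          using tagged_division_ofD(2,3)[OF tag, of t I] sub by force+
        then show "0 \<le> h t I" by (rule nonneg)
      qed
      have "measure lebesgue (\<Union>M) \<le> (\<Sum>I\<in>M. measure lebesgue I)"
        using finM meas M(1) D(1) by (intro measure_Union_le) blast+
      then have "\<eta> * measure lebesgue (\<Union>D) \<le> \<eta> * (\<Sum>I\<in>M. measure lebesgue I)"
        using \<eta> M(2) by simp
      also have "\<dots> \<le> (\<Sum>I\<in>M. h (\<tau> I) I)"
        unfolding sum_distrib_left using \<tau> by (intro sum_mono) (simp add: bad_def)
      also have "\<dots> = (\<Sum>(t, I)\<in>(\<lambda>I. (\<tau> I, I)) ` M. h t I)"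
        by (subst sum.reindex) (auto simp: inj_on_def)
      also have "\<dots> \<le> (\<Sum>(t, I)\<in>p. h t I)"
        using pD p(3) by (intro sum_mono2) auto
      also have "\<dots> < \<eta> * e"
        using p small by blast
      finally show ?thesis using \<eta> by simp
    qed
    show "\<exists>T. E \<eta> \<subseteq> T \<and> T \<in> lmeasurable \<and> measure lebesgue T \<le> e"
      using cover fmeasurable_Union_bound[OF count meas bound] measure_Union_bound[OF count meas bound]
      by blast
  qed
  (* at 1 the interval dyadic_at n t leaves [0,1] *)
  have "negligible ((\<Union>j. E (1 / Suc j)) \<union> {1})"
    by (intro negligible_Un negligible_countable_Union negl) (auto intro: negl)
  then have "AE t in lebesgue. t \<notin> (\<Union>j. E (1 / Suc j)) \<union> {1}"
    unfolding negligible_iff_null_sets by (rule AE_not_in)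
  then have "AE t in lebesgue. t \<in> {0..1} \<longrightarrow> (\<lambda>n. 2 ^ n * h t (dyadic_at n t)) \<longlonglongrightarrow> 0"
  proof (rule AE_mp, intro AE_I2 impI)
    fix t :: real
    assume t: "t \<notin> (\<Union>j. E (1 / Suc j)) \<union> {1}" "t \<in> {0..1}"
    then have t1: "t \<in> {0..<1}" by auto
    show "(\<lambda>n. 2 ^ n * h t (dyadic_at n t)) \<longlonglongrightarrow> 0"
    proof (rule order_tendstoI)
      fix a :: real assume "a < 0"
      moreover have "0 \<le> 2 ^ n * h t (dyadic_at n t)" for n
        using nonneg[OF t(2) dyadic_in_subintervals[OF floor_dyadic_bounds[OF t1]]] by simp
      ultimately show "\<forall>\<^sub>F n in sequentially. a < 2 ^ n * h t (dyadic_at n t)"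
        by (auto intro: always_eventually less_le_trans)
    next
      fix a :: real assume "0 < a"
      then obtain j where j: "1 / real (Suc j) < a"
        using nat_approx_posE by blast
      have "\<forall>\<^sub>F n in sequentially. 2 ^ n * h t (dyadic_at n t) \<le> 1 / Suc j"
        using t t1 by (auto simp: E_def)
      then show "\<forall>\<^sub>F n in sequentially. 2 ^ n * h t (dyadic_at n t) < a"
        by (rule eventually_mono) (use j in linarith)
    qed
  qed
  then show ?thesis
    by (subst AE_restrict_space_iff) auto
qed

section \<open>Dyadic difference quotients as simple multifunctions\<close>

lemma hausdorff_dist_self:
  assumes "A \<noteq> {}"
  shows "hausdorff_dist A A = 0"
  using assms by (simp add: hausdorff_dist_def)

lemma simple_multifunction_floor:
  "simple_multifunction (\<lambda>t. G \<lfloor>2 ^ n * t\<rfloor>)"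
proof -
  define L where "L k = {t \<in> {0..1::real}. \<lfloor>2 ^ n * t\<rfloor> = k}" for k
  have "L k = {0..1} \<inter> {of_int k / 2 ^ n ..< (of_int k + 1) / 2 ^ n}" for k
    unfolding L_def by (auto simp: floor_eq_iff field_simps)
  then have meas: "L k \<in> sets lebesgue" for k
    by simp
  have "\<lfloor>2 ^ n * t\<rfloor> \<in> {0..2 ^ n}" if "t \<in> {0..1}" for t :: real
  proof -
    have "\<lfloor>2 ^ n * t\<rfloor> \<le> \<lfloor>of_int (2 ^ n) :: real\<rfloor>"
      using that by (intro floor_mono) simp
    then show ?thesis
      using that unfolding floor_of_int by simp
  qed
  then have cover: "\<Union>(L ` {0..2 ^ n}) = {0..1}"
    by (auto simp: L_def)
  have "disjoint (L ` {0..2 ^ n})"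
    by (auto simp: disjoint_def L_def)
  moreover have "(\<lambda>t. G \<lfloor>2 ^ n * t\<rfloor>) constant_on L k" for k
    unfolding constant_on_def by (rule exI[of _ "G k"]) (simp add: L_def)
  ultimately show ?thesis
    unfolding simple_multifunction_def
    using cover meas by (intro exI[of _ "L ` {0..2 ^ n}"] conjI) auto
qed

theorem proposition2p8:
  fixes \<Gamma> :: "real \<Rightarrow> 'a::banach set"
  assumes "\<Gamma> \<in> {0..1} \<rightarrow> cwk"
    and "variationally_Henstock_integrable \<Gamma>"
  shows "Bochner_measurable \<Gamma>"
proof -
  obtain \<Phi> where \<Phi>: "\<Phi> \<in> subintervals \<rightarrow> cwk"
    and null: "\<And>\<epsilon>. \<epsilon> > 0 \<Longrightarrow> \<exists>\<delta> :: real \<Rightarrow> real. (\<forall>t\<in>{0..1}. 0 < \<delta> t) \<and>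
        (\<forall>p. Perron_partition p \<and> (\<lambda>t. {t - \<delta> t <..< t + \<delta> t}) fine p \<longrightarrow>
          (\<Sum>(t, I)\<in>p. hausdorff_dist (\<Phi> I) ((*\<^sub>R) (measure lborel I) ` \<Gamma> t)) < \<epsilon>)"
    using assms(2) unfolding variationally_Henstock_integrable_def by blast
  define h where "h t I = hausdorff_dist (\<Phi> I) ((*\<^sub>R) (measure lborel I) ` \<Gamma> t)" for t I
  have \<Gamma>_cwk: "\<Gamma> t \<in> cwk" if "t \<in> {0..1}" for t
    using assms(1) that by blast
  have \<Phi>_cwk: "\<Phi> I \<in> cwk" if "I \<in> subintervals" for I
    using \<Phi> that by blast
  have lim: "AE t in lebesgue_on {0..1}. (\<lambda>n. 2 ^ n * h t (dyadic_at n t)) \<longlonglongrightarrow> 0"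
  proof (rule variationally_null_imp_dyadic_limit)
    show "0 \<le> h t I" if "I \<in> subintervals" for t I
      using \<Phi>_cwk[OF that] unfolding h_def
      by (intro hausdorff_dist_nonneg cwk_bounded cwk_nonempty)
  qed (unfold h_def, rule null)
  (* the second branch is met only at t = 1, whose dyadic interval leaves [0,1] *)
  define G where "G n k = (if 0 \<le> k \<and> k < 2 ^ n then (*\<^sub>R) (2 ^ n) ` \<Phi> (dyadic n k) else \<Gamma> 1)" for n k
  have G_cwk: "G n k \<in> cwk" for n k
    using \<Gamma>_cwk[of 1] \<Phi>_cwk[OF dyadic_in_subintervals] by (simp add: G_def cwk_scaleR)
  have dist: "hausdorff_dist (G n \<lfloor>2 ^ n * t\<rfloor>) (\<Gamma> t) \<le> 2 ^ n * h t (dyadic_at n t)"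
    if t: "t \<in> {0..<1}" for n t
  proof -
    let ?D = "dyadic_at n t" and ?B = "(*\<^sub>R) (1 / 2 ^ n) ` \<Gamma> t"
    have D: "\<Phi> ?D \<in> cwk"
      using \<Phi>_cwk[OF dyadic_in_subintervals[OF floor_dyadic_bounds[OF t]]] .
    have B: "?B \<in> cwk"
      using \<Gamma>_cwk t by (intro cwk_scaleR) auto
    have G: "G n \<lfloor>2 ^ n * t\<rfloor> = (*\<^sub>R) (2 ^ n) ` \<Phi> ?D"
      using floor_dyadic_bounds[OF t, of n] by (simp add: G_def)
    have \<Gamma>: "\<Gamma> t = (*\<^sub>R) (2 ^ n) ` ?B"
      by (simp add: image_image)
    have "hausdorff_dist ((*\<^sub>R) (2 ^ n) ` \<Phi> ?D) ((*\<^sub>R) (2 ^ n) ` ?B) \<le> 2 ^ n * hausdorff_dist (\<Phi> ?D) ?B"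
      by (intro hausdorff_dist_scaleR_image_le cwk_bounded cwk_nonempty D B) simp
    then show ?thesis
      unfolding G \<Gamma>[symmetric] h_def measure_dyadic .
  qed
  have "AE t in lebesgue_on {0..1}. (\<lambda>n. hausdorff_dist (G n \<lfloor>2 ^ n * t\<rfloor>) (\<Gamma> t)) \<longlonglongrightarrow> 0"
    using lim
  proof (rule AE_mp, intro AE_I2 impI)
    fix t :: real
    assume "t \<in> space (lebesgue_on {0..1})" and lim: "(\<lambda>n. 2 ^ n * h t (dyadic_at n t)) \<longlonglongrightarrow> 0"
    then have t: "t \<in> {0..1}" by simp
    show "(\<lambda>n. hausdorff_dist (G n \<lfloor>2 ^ n * t\<rfloor>) (\<Gamma> t)) \<longlonglongrightarrow> 0"
    proof (cases "t = 1")
      case True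
      have "\<lfloor>2 ^ n :: real\<rfloor> = 2 ^ n" for n
        using floor_of_int[of "2 ^ n", where 'a=real] by simp
      then have "G n \<lfloor>2 ^ n * t\<rfloor> = \<Gamma> t" for n
        using True by (simp add: G_def)
      then show ?thesis
        using hausdorff_dist_self[OF cwk_nonempty[OF \<Gamma>_cwk[OF t]]] by simp
    next
      case False
      then have "t \<in> {0..<1}" using t by simp
      show ?thesis
      proof (rule tendsto_sandwich[OF always_eventually always_eventually tendsto_const lim]; intro allI)
        show "0 \<le> hausdorff_dist (G n \<lfloor>2 ^ n * t\<rfloor>) (\<Gamma> t)" for n
          by (intro hausdorff_dist_nonneg cwk_bounded cwk_nonempty G_cwk)
      qed (rule dist[OF \<open>t \<in> {0..<1}\<close>])
    qed
  qed
  then show ?thesis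
    unfolding Bochner_measurable_def
    using simple_multifunction_floor G_cwk
    by (intro exI[of _ "\<lambda>n t. G n \<lfloor>2 ^ n * t\<rfloor>"]) auto
qed

end
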